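(* Given partitions $\lambda,\mu,\pi$ of the same size in unary, where $\lambda$ is a hook, whether $t^\lambda_{\mu,\pi}>0$ can be decided in polynomial time.
   Context: A hook is a partition of the form $(p,1^q)$. $\alpha^T$ denotes the vector of column lengths of a partition $\alpha$. For finite $P\subseteq\mathbb{N}^3$ the marginals are $(x_P,y_P,z_P)$ with $x_P(i)$ the number of points of $P$ with $x$-coordinate $i$, etc.; $t^\lambda_{\mu,\pi}$ is the number of finite $P\subseteq\mathbb{N}^3$ with marginals $(\lambda^T,\mu^T,\pi^T)$. *)

theory Defs
  imports "HOL-Computational_Algebra.Polynomial"
begin

section \<open>Partitions and point sets with prescribed marginals\<close>

definition is_partition :: "nat list \<Rightarrow> bool" where
  "is_partition \<alpha> \<longleftrightarrow> sorted_wrt (\<ge>) \<alpha> \<and> (\<forall>a \<in> set \<alpha>. a > 0)"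

definition is_hook :: "nat list \<Rightarrow> bool" where
  "is_hook \<alpha> \<longleftrightarrow> (\<exists>p q. p \<ge> 1 \<and> \<alpha> = p # replicate q 1)"

text \<open>The vector of column lengths is indexed from 0 and padded with zeros, so that it has the same
  type as a marginal of a subset of \<open>\<nat>\<^sup>3\<close> with \<open>0 \<in> \<nat>\<close>.\<close>

definition column_lengths :: "nat list \<Rightarrow> nat \<Rightarrow> nat" where
  "column_lengths \<alpha> i = card {j. j < length \<alpha> \<and> i < \<alpha> ! j}"

definition x_marginal :: "(nat \<times> nat \<times> nat) set \<Rightarrow> nat \<Rightarrow> nat" where
  "x_marginal P i = card {(x, y, z) \<in> P. x = i}"

definition y_marginal :: "(nat \<times> nat \<times> nat) set \<Rightarrow> nat \<Rightarrow> nat" where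
  "y_marginal P i = card {(x, y, z) \<in> P. y = i}"

definition z_marginal :: "(nat \<times> nat \<times> nat) set \<Rightarrow> nat \<Rightarrow> nat" where
  "z_marginal P i = card {(x, y, z) \<in> P. z = i}"

definition point_set_count :: "nat list \<Rightarrow> nat list \<Rightarrow> nat list \<Rightarrow> nat" where
  "point_set_count lam \<mu> \<pi> = card {P. finite P \<and>
     x_marginal P = column_lengths lam \<and>
     y_marginal P = column_lengths \<mu> \<and>
     z_marginal P = column_lengths \<pi>}"


section \<open>Deterministic multi-tape Turing machines\<close>

datatype direction = Move_Left | Stay | Move_Right

text \<open>States and symbols are initial segments of the natural numbers; symbol 0 is the blank. The
  transition function maps a state and the symbols under the heads to a new state and, for each
  tape, the symbol to write and the head movement.\<close>

record tm =
  tm_tapes :: nat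
  tm_symbols :: nat
  tm_states :: nat
  tm_start :: nat
  tm_accept :: nat
  tm_reject :: nat
  tm_delta :: "nat \<Rightarrow> nat list \<Rightarrow> nat \<times> (nat \<times> direction) list"

definition wf_tm :: "tm \<Rightarrow> bool" where
  "wf_tm M \<longleftrightarrow>
     tm_tapes M \<ge> 1 \<and> tm_symbols M \<ge> 1 \<and>
     tm_start M < tm_states M \<and> tm_accept M < tm_states M \<and> tm_reject M < tm_states M \<and>
     tm_accept M \<noteq> tm_reject M \<and>
     (\<forall>s syms. s < tm_states M \<and> length syms = tm_tapes M \<and> set syms \<subseteq> {..<tm_symbols M} \<longrightarrow>
        (case tm_delta M s syms of (s', acts) \<Rightarrow>
           s' < tm_states M \<and> length acts = tm_tapes M \<and> fst ` set acts \<subseteq> {..<tm_symbols M}))"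

text \<open>A tape is infinite in both directions and is stored with the position of its head.\<close>

type_synonym tape = "(int \<Rightarrow> nat) \<times> int"

type_synonym config = "nat \<times> tape list"

definition tape_read :: "tape \<Rightarrow> nat" where
  "tape_read t = fst t (snd t)"

fun head_offset :: "direction \<Rightarrow> int" where
  "head_offset Move_Left = -1"
| "head_offset Stay = 0"
| "head_offset Move_Right = 1"

fun tape_act :: "nat \<times> direction \<Rightarrow> tape \<Rightarrow> tape" where
  "tape_act (a, d) (f, h) = (f(h := a), h + head_offset d)"

text \<open>Accepting and rejecting configurations are fixed points, so that a machine that has halted
  keeps its verdict.\<close>

fun tm_step :: "tm \<Rightarrow> config \<Rightarrow> config" where
  "tm_step M (s, ts) =
     (if s = tm_accept M \<or> s = tm_reject M then (s, ts)
      else case tm_delta M s (map tape_read ts) of (s', acts) \<Rightarrow> (s', map2 tape_act acts ts))"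

definition input_tape :: "nat list \<Rightarrow> tape" where
  "input_tape w = ((\<lambda>i. if 0 \<le> i \<and> i < int (length w) then w ! nat i else 0), 0)"

definition tm_init :: "tm \<Rightarrow> nat list \<Rightarrow> config" where
  "tm_init M w = (tm_start M, input_tape w # replicate (tm_tapes M - 1) (input_tape []))"

definition tm_verdict_within :: "tm \<Rightarrow> nat list \<Rightarrow> nat \<Rightarrow> bool \<Rightarrow> bool" where
  "tm_verdict_within M w n b \<longleftrightarrow>
     (\<exists>k \<le> n. fst ((tm_step M ^^ k) (tm_init M w)) = (if b then tm_accept M else tm_reject M))"

text \<open>\<open>A\<close> is the set of admissible instances, presented to the machine through the encoding \<open>enc\<close>, and
  \<open>Q\<close> is the question. The machine is not constrained on words that do not encode an admissible
  instance.\<close>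

definition poly_time_decidable :: "('a \<Rightarrow> nat list) \<Rightarrow> 'a set \<Rightarrow> ('a \<Rightarrow> bool) \<Rightarrow> bool" where
  "poly_time_decidable enc A Q \<longleftrightarrow>
     (\<exists>M (p :: nat poly). wf_tm M \<and>
        (\<forall>x \<in> A. set (enc x) \<subseteq> {1..<tm_symbols M} \<and>
                 tm_verdict_within M (enc x) (poly p (length (enc x))) (Q x)))"


section \<open>Unary encoding\<close>

text \<open>A part \<open>a\<close> is written as \<open>a\<close> strokes (symbol 1) closed by the symbol 2; a partition is closed by the
  symbol 3.\<close>

definition unary_partition :: "nat list \<Rightarrow> nat list" where
  "unary_partition \<alpha> = concat (map (\<lambda>a. replicate a 1 @ [2]) \<alpha>) @ [3]"

fun unary_triple :: "nat list \<times> nat list \<times> nat list \<Rightarrow> nat list" where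
  "unary_triple (lam, \<mu>, \<pi>) = unary_partition lam @ unary_partition \<mu> @ unary_partition \<pi>"

end

theory Submission
  imports Defs
begin

text \<open>If \<open>lam = (p, 1\<^sup>q)\<close>, its column lengths are \<open>(q + 1, 1, \<dots>, 1)\<close>, so a point set with the required
  marginals consists of \<open>q + 1\<close> points in the slice \<open>x = 0\<close> and one point in each of \<open>p - 1\<close> further
  slices. The latter points are unconstrained among each other, so they can absorb any residual
  marginals. Hence the question is whether some set \<open>S \<subseteq> \<nat>\<^sup>2\<close> of \<open>q + 1\<close> points has row and column
  sums bounded by the column lengths of \<open>\<mu>\<close> and \<open>\<pi>\<close>. By the max-flow min-cut theorem for the complete
  bipartite graph (a form of the Gale--Ryser theorem) this holds iff, for all \<open>k\<close>, the boxes of \<open>\<mu>\<close>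
  outside the first \<open>k\<close> columns and the boxes of \<open>\<pi>\<close> in the first \<open>k\<close> rows together number at least
  \<open>q + 1\<close>. A two-tape machine checks these inequalities one after the other: during pass \<open>k\<close> it counts
  the unmarked strokes of \<open>\<mu>\<close> and the marked strokes of \<open>\<pi>\<close> against the length of \<open>lam\<close>, and marks one
  more stroke in every part of \<open>\<mu>\<close> and one more part of \<open>\<pi>\<close>.\<close>

section \<open>Subgraphs with bounded degrees\<close>

lemma card_insert_edge_rect:
  assumes "finite F" "(a, b) \<notin> F"
  shows "card (insert (a, b) F \<inter> I \<times> J) = card (F \<inter> I \<times> J) + (if a \<in> I \<and> b \<in> J then 1 else 0)"
  using assms by (auto simp: Int_insert_left)

text \<open>Induction on the edges. If deleting an edge keeps all cuts at least \<open>N\<close>, it is deleted; otherwise it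
  crosses a tight cut \<open>(I, J)\<close> and is chosen. Submodularity then shows that no cut \<open>(I', J')\<close> drops below
  \<open>N - 1\<close>: the edge is counted for \<open>(I, J)\<close>, but for neither of the two uncrossed pairs.\<close>

lemma capacitated_subgraph:
  assumes "finite R" "finite C" "finite E" "E \<subseteq> R \<times> C"
    and "\<And>I J. I \<subseteq> R \<Longrightarrow> J \<subseteq> C \<Longrightarrow> N \<le> sum r (R - I) + sum c (C - J) + card (E \<inter> I \<times> J)"
  shows "\<exists>S\<subseteq>E. card S = (N::nat) \<and> (\<forall>i\<in>R. card {j. (i, j) \<in> S} \<le> r i)
           \<and> (\<forall>j\<in>C. card {i. (i, j) \<in> S} \<le> c j)"
  using assms(3-5)
proof (induction E arbitrary: r c N rule: finite_induct)
  case empty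
  \<comment> \<open>The cut \<open>(R, C)\<close> has capacity 0 here, which forces
    \<open>N = 0\<close>.\<close>
  from empty(2)[of R C] show ?case by auto
next
  case (insert e F)
  obtain a b where e: "e = (a, b)" by force
  have ab: "a \<in> R" "b \<in> C" and FRC: "F \<subseteq> R \<times> C" using insert.prems(1) e by auto
  \<comment> \<open>Capacities are measured after deleting \<open>e\<close>. Deletion lowers a cut
    by one exactly when \<open>e\<close> lies in the rectangle, so a cut below \<open>N\<close> must
    equal \<open>N - 1\<close> and contain \<open>e\<close>.\<close>
  define cut where "cut I J = sum r (R - I) + sum c (C - J) + card (F \<inter> I \<times> J)" for I J
  have cutE: "N \<le> cut I J + (if a \<in> I \<and> b \<in> J then 1 else 0)" if "I \<subseteq> R" "J \<subseteq> C" for I J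
    using insert.prems(2)[OF that] card_insert_edge_rect[of F a b I J] insert.hyps
    by (simp add: e cut_def)
  show ?case
  proof (cases "\<forall>I J. I \<subseteq> R \<longrightarrow> J \<subseteq> C \<longrightarrow> N \<le> cut I J")
    case True
    then have "\<exists>S\<subseteq>F. card S = N \<and> (\<forall>i\<in>R. card {j. (i, j) \<in> S} \<le> r i)
           \<and> (\<forall>j\<in>C. card {i. (i, j) \<in> S} \<le> c j)"
      by (intro insert.IH FRC) (auto simp: cut_def)
    then show ?thesis by blast
  next
    case False
    then obtain I J where IJ: "I \<subseteq> R" "J \<subseteq> C" "cut I J < N" by (auto simp: not_le)
    with cutE[of I J] have tight: "a \<in> I" "b \<in> J" "Suc (cut I J) = N" by (auto split: if_splits)
    \<comment> \<open>Moving \<open>a\<close> out of \<open>I\<close> raises the deficient cut by at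
      most \<open>r a\<close>. The new rectangle misses \<open>e\<close>, so its capacity is at
      least \<open>N\<close>.\<close>
    have ra: "r a \<ge> 1"
    proof -
      have "R - (I - {a}) = insert a (R - I)" using ab by auto
      then have "sum r (R - (I - {a})) = r a + sum r (R - I)"
        using assms(1) tight by simp
      moreover have "card (F \<inter> (I - {a}) \<times> J) \<le> card (F \<inter> I \<times> J)"
        by (intro card_mono) (use insert.hyps in auto)
      ultimately show ?thesis using cutE[OF subset_trans[OF Diff_subset IJ(1)] IJ(2), of "{a}"] tight
        by (simp add: cut_def)
    qed
    have cb: "c b \<ge> 1"
    proof -
      have "C - (J - {b}) = insert b (C - J)" using ab by auto
      then have "sum c (C - (J - {b})) = c b + sum c (C - J)"
        using assms(2) tight by simp
      moreover have "card (F \<inter> I \<times> (J - {b})) \<le> card (F \<inter> I \<times> J)"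
        by (intro card_mono) (use insert.hyps in auto)
      ultimately show ?thesis using cutE[OF IJ(1) subset_trans[OF Diff_subset IJ(2)], of "{b}"] tight
        by (simp add: cut_def)
    qed
    define r' where "r' = r(a := r a - 1)"
    define c' where "c' = c(b := c b - 1)"
    have sr: "sum r' (R - I') + (if a \<in> I' then 0 else 1) = sum r (R - I')" for I'
    proof (cases "a \<in> I'")
      case True
      then have "sum r' (R - I') = sum r (R - I')" by (intro sum.cong) (auto simp: r'_def)
      with True show ?thesis by simp
    next
      case False
      have "sum r' (R - I' - {a}) = sum r (R - I' - {a})" by (intro sum.cong) (auto simp: r'_def)
      with False ra ab assms(1) show ?thesis
        by (simp add: sum.remove[of "R - I'" a] r'_def)
    qed
    have sc: "sum c' (C - J') + (if b \<in> J' then 0 else 1) = sum c (C - J')" for J'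
    proof (cases "b \<in> J'")
      case True
      then have "sum c' (C - J') = sum c (C - J')" by (intro sum.cong) (auto simp: c'_def)
      with True show ?thesis by simp
    next
      case False
      have "sum c' (C - J' - {b}) = sum c (C - J' - {b})" by (intro sum.cong) (auto simp: c'_def)
      with False cb ab assms(2) show ?thesis
        by (simp add: sum.remove[of "C - J'" b] c'_def)
    qed
    have "N - 1 \<le> sum r' (R - I') + sum c' (C - J') + card (F \<inter> I' \<times> J')"
      if s: "I' \<subseteq> R" "J' \<subseteq> C" for I' J'
    proof (cases "a \<in> I' \<or> b \<in> J'")
      \<comment> \<open>If both endpoints are inside, no capacity was decremented but
        \<open>e\<close> may be missing; if only one is inside, \<open>e\<close> is not counted and
        one decrement applies. Either way the loss is at most one.\<close>
      case True
      with cutE[OF s] sr[of I'] sc[of J'] show ?thesis by (auto simp: cut_def split: if_splits)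
    next
      case False
      have 1: "sum r (R - I \<inter> I') + sum r (R - (I \<union> I')) = sum r (R - I) + sum r (R - I')"
        using sum.union_inter[of "R - I" "R - I'" r] assms(1) by (simp add: Diff_Int Diff_Un)
      have 2: "sum c (C - (J \<union> J')) + sum c (C - J \<inter> J') = sum c (C - J) + sum c (C - J')"
        using sum.union_inter[of "C - J" "C - J'" c] assms(2) by (simp add: Diff_Int Diff_Un)
      \<comment> \<open>The uncrossed rectangles lie in the union of the old ones and have the same
        intersection, so together they hold no more edges.\<close>
      let ?A = "F \<inter> (I \<inter> I') \<times> (J \<union> J')" and ?A' = "F \<inter> (I \<union> I') \<times> (J \<inter> J')"
      let ?B = "F \<inter> I \<times> J" and ?B' = "F \<inter> I' \<times> J'"
      have "card (?A \<union> ?A') \<le> card (?B \<union> ?B')" "card (?A \<inter> ?A') \<le> card (?B \<inter> ?B')"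
        by (rule card_mono; use insert.hyps in auto)+
      then have "card ?A + card ?A' \<le> card ?B + card ?B'"
        using card_Un_Int[of ?A ?A'] card_Un_Int[of ?B ?B'] insert.hyps(1) by simp
      with 1 2 have "cut (I \<inter> I') (J \<union> J') + cut (I \<union> I') (J \<inter> J') \<le> cut I J + cut I' J'"
        unfolding cut_def by linarith
      moreover have "N \<le> cut (I \<inter> I') (J \<union> J')" "N \<le> cut (I \<union> I') (J \<inter> J')"
        using cutE[of "I \<inter> I'" "J \<union> J'"] cutE[of "I \<union> I'" "J \<inter> J'"] IJ s False by auto
      \<comment> \<open>Here both decrements apply, so a surplus of one is required. It follows from
        \<open>2 * N \<le> (N - 1) + cut I' J'\<close>.\<close>
      ultimately have "N + 1 \<le> cut I' J'" using tight by linarith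
      with sr[of I'] sc[of J'] False show ?thesis by (auto simp: cut_def)
    qed
    from insert.IH[OF FRC this] obtain S where S: "S \<subseteq> F" "card S = N - 1"
      "\<And>i. i \<in> R \<Longrightarrow> card {j. (i, j) \<in> S} \<le> r' i"
      "\<And>j. j \<in> C \<Longrightarrow> card {i. (i, j) \<in> S} \<le> c' j" by blast
    have finS: "finite S" using S(1) insert.hyps(1) finite_subset by blast
    have "e \<notin> S" using S(1) insert.hyps(2) by auto
    then have "card (insert e S) = N" using finS S(2) tight by simp
    moreover have "card {j. (i, j) \<in> insert e S} \<le> r i" if "i \<in> R" for i
    proof (cases "i = a")
      case True
      then have "{j. (i, j) \<in> insert e S} = insert b {j. (a, j) \<in> S}" by (auto simp: e)
      then show ?thesis using S(3)[OF that] True ra card_insert_le_m1[of "r a"]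
        by (simp add: r'_def)
    next
      case False
      then show ?thesis using S(3)[OF that] by (simp add: r'_def e)
    qed
    moreover have "card {i. (i, j) \<in> insert e S} \<le> c j" if "j \<in> C" for j
    proof (cases "j = b")
      case True
      then have "{i. (i, j) \<in> insert e S} = insert a {i. (i, b) \<in> S}" by (auto simp: e)
      then show ?thesis using S(4)[OF that] True cb card_insert_le_m1[of "c b"]
        by (simp add: c'_def)
    next
      case False
      then show ?thesis using S(4)[OF that] by (simp add: c'_def e)
    qed
    ultimately show ?thesis using S(1) by (intro exI[of _ "insert e S"]) auto
  qed
qed

section \<open>The dominance criterion\<close>

lemma sum_card_swap:
  assumes "finite A" "finite B"
  shows "(\<Sum>i\<in>A. card {j \<in> B. Q i j}) = (\<Sum>j\<in>B. card {i \<in> A. Q i j})"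
  using sum.swap_restrict[OF assms, of "\<lambda>_ _. 1::nat" Q] by simp

lemma column_lengths_alt: "column_lengths \<alpha> i = card {j \<in> {..<length \<alpha>}. i < \<alpha> ! j}"
  by (simp add: column_lengths_def)

lemma column_lengths_eq_0: "sum_list \<alpha> \<le> i \<Longrightarrow> column_lengths \<alpha> i = 0"
proof -
  assume "sum_list \<alpha> \<le> i"
  then have "\<alpha> ! j \<le> i" if "j < length \<alpha>" for j
    using that member_le_sum_list[of "\<alpha> ! j" \<alpha>] by force
  then have "{j. j < length \<alpha> \<and> i < \<alpha> ! j} = {}" using linorder_not_less by blast
  then show ?thesis by (simp add: column_lengths_def)
qed

lemma sum_column_lengths: "(\<Sum>i<sum_list \<alpha>. column_lengths \<alpha> i) = sum_list \<alpha>"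
proof -
  have "(\<Sum>i<sum_list \<alpha>. column_lengths \<alpha> i)
      = (\<Sum>j<length \<alpha>. card {i \<in> {..<sum_list \<alpha>}. i < \<alpha> ! j})"
    unfolding column_lengths_alt by (rule sum_card_swap) auto
  also have "\<dots> = (\<Sum>j<length \<alpha>. \<alpha> ! j)"
  proof (rule sum.cong[OF refl])
    fix j assume "j \<in> {..<length \<alpha>}"
    then have "\<alpha> ! j \<le> sum_list \<alpha>" by (simp add: member_le_sum_list)
    then have "{i \<in> {..<sum_list \<alpha>}. i < \<alpha> ! j} = {..<\<alpha> ! j}" by auto
    then show "card {i \<in> {..<sum_list \<alpha>}. i < \<alpha> ! j} = \<alpha> ! j" by simp
  qed
  also have "\<dots> = sum_list \<alpha>" by (simp add: sum_list_sum_nth atLeast0LessThan)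
  finally show ?thesis .
qed

text \<open>Removing \<open>card I\<close> columns deletes at most \<open>card I\<close> boxes from
  each row, and \<open>R\<close> contains every nonempty column.\<close>

lemma sum_column_lengths_Diff_ge:
  assumes "finite R" "{..<sum_list \<alpha>} \<subseteq> R" "finite I"
  shows "(\<Sum>a\<leftarrow>\<alpha>. a - card I) \<le> sum (column_lengths \<alpha>) (R - I)"
proof -
  have "sum (column_lengths \<alpha>) (R - I) = (\<Sum>j<length \<alpha>. card {i \<in> R - I. i < \<alpha> ! j})"
    unfolding column_lengths_alt by (rule sum_card_swap) (use assms in auto)
  also have "\<dots> \<ge> (\<Sum>j<length \<alpha>. \<alpha> ! j - card I)"
  proof (rule sum_mono)
    fix j assume "j \<in> {..<length \<alpha>}"
    then have "\<alpha> ! j \<le> sum_list \<alpha>" by (simp add: member_le_sum_list)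
    then have "{..<\<alpha> ! j} - I \<subseteq> {i \<in> R - I. i < \<alpha> ! j}" using assms(2) by fastforce
    then have "card ({..<\<alpha> ! j} - I) \<le> card {i \<in> R - I. i < \<alpha> ! j}"
      using assms(1) by (intro card_mono) auto
    moreover have "\<alpha> ! j - card I \<le> card ({..<\<alpha> ! j} - I)"
      using diff_card_le_card_Diff[OF assms(3), of "{..<\<alpha> ! j}"] by simp
    ultimately show "\<alpha> ! j - card I \<le> card {i \<in> R - I. i < \<alpha> ! j}" by simp
  qed
  finally show ?thesis by (simp add: sum_list_sum_nth atLeast0LessThan)
qed

text \<open>Removing the first \<open>k\<close> columns is the extremal case: a row of length
  \<open>a\<close> loses \<open>min a k\<close> boxes.\<close>

lemma sum_column_lengths_tail:
  assumes "sum_list \<alpha> \<le> m"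
  shows "sum (column_lengths \<alpha>) ({..<m} - {..<k}) = (\<Sum>a\<leftarrow>\<alpha>. a - k)"
proof -
  have "sum (column_lengths \<alpha>) ({..<m} - {..<k})
      = (\<Sum>j<length \<alpha>. card {i \<in> {..<m} - {..<k}. i < \<alpha> ! j})"
    unfolding column_lengths_alt by (rule sum_card_swap) auto
  also have "\<dots> = (\<Sum>j<length \<alpha>. \<alpha> ! j - k)"
  proof (rule sum.cong[OF refl])
    fix j assume "j \<in> {..<length \<alpha>}"
    then have "\<alpha> ! j \<le> m" using assms member_le_sum_list[of "\<alpha> ! j" \<alpha>] by force
    then have "{i \<in> {..<m} - {..<k}. i < \<alpha> ! j} = {k..<\<alpha> ! j}" by auto
    then show "card {i \<in> {..<m} - {..<k}. i < \<alpha> ! j} = \<alpha> ! j - k" by simp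
  qed
  finally show ?thesis by (simp add: sum_list_sum_nth atLeast0LessThan)
qed

lemma sum_card_first_parts:
  assumes "sum_list \<alpha> \<le> m"
  shows "(\<Sum>i<m. card {j. j < length \<alpha> \<and> j < k \<and> i < \<alpha> ! j}) = sum_list (take k \<alpha>)"
proof -
  let ?B = "{..<min (length \<alpha>) k}"
  have "(\<Sum>i<m. card {j. j < length \<alpha> \<and> j < k \<and> i < \<alpha> ! j}) = (\<Sum>i<m. card {j \<in> ?B. i < \<alpha> ! j})"
    by (intro sum.cong arg_cong[of _ _ card]) auto
  also have "\<dots> = (\<Sum>j\<in>?B. card {i \<in> {..<m}. i < \<alpha> ! j})"
    by (rule sum_card_swap) auto
  also have "\<dots> = (\<Sum>j\<in>?B. \<alpha> ! j)"
  proof (rule sum.cong[OF refl])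
    fix j assume "j \<in> ?B"
    then have "\<alpha> ! j \<le> m" using assms member_le_sum_list[of "\<alpha> ! j" \<alpha>] by force
    then have "{i \<in> {..<m}. i < \<alpha> ! j} = {..<\<alpha> ! j}" by auto
    then show "card {i \<in> {..<m}. i < \<alpha> ! j} = \<alpha> ! j" by simp
  qed
  also have "\<dots> = sum_list (take k \<alpha>)" by (simp add: sum_list_sum_nth atLeast0LessThan)
  finally show ?thesis .
qed

text \<open>In a sorted partition column \<open>i\<close> occupies an initial segment of the rows.
  Either it ends before row \<open>k\<close> and the truncation loses nothing, or it fills all of
  the first \<open>k\<close> rows.\<close>

lemma min_column_lengths:
  assumes "sorted_wrt (\<ge>) \<alpha>"
  shows "min (column_lengths \<alpha> i) k \<le> card {j. j < length \<alpha> \<and> j < k \<and> i < \<alpha> ! j}"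
proof (cases "\<exists>j < length \<alpha>. j < k \<and> \<alpha> ! j \<le> i")
  case True
  then obtain j where j: "j < length \<alpha>" "j < k" "\<alpha> ! j \<le> i" by blast
  have "j' < j" if "j' < length \<alpha>" "i < \<alpha> ! j'" for j'
  proof (rule ccontr)
    assume "\<not> j' < j"
    with that j have "j < j'" by (cases "j = j'") auto
    with assms that have "\<alpha> ! j' \<le> \<alpha> ! j" by (auto simp: sorted_wrt_iff_nth_less)
    with that j show False by simp
  qed
  with j(2) have "{j. j < length \<alpha> \<and> j < k \<and> i < \<alpha> ! j} = {j. j < length \<alpha> \<and> i < \<alpha> ! j}"
    by fastforce
  then show ?thesis by (simp add: column_lengths_def)
next
  case False
  show ?thesis
  proof (cases "k \<le> length \<alpha>")
    case True
    with False have "{j. j < length \<alpha> \<and> j < k \<and> i < \<alpha> ! j} = {..<k}" by (auto simp: not_le)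
    then show ?thesis by simp
  next
    case F: False
    then have "{j. j < length \<alpha> \<and> j < k \<and> i < \<alpha> ! j} = {j. j < length \<alpha> \<and> i < \<alpha> ! j}"
      by auto
    then show ?thesis by (simp add: column_lengths_def)
  qed
qed

section \<open>Plane sets with bounded row and column sums\<close>

definition dominance :: "nat list \<Rightarrow> nat list \<Rightarrow> nat \<Rightarrow> nat \<Rightarrow> bool" where
  "dominance \<mu> \<pi> N k \<longleftrightarrow> N \<le> (\<Sum>a\<leftarrow>\<mu>. a - k) + sum_list (take k \<pi>)"

definition bounded_subset :: "nat list \<Rightarrow> nat list \<Rightarrow> (nat \<times> nat) set \<Rightarrow> bool" where
  "bounded_subset \<mu> \<pi> S \<longleftrightarrow> finite S \<and> (\<forall>i. card {j. (i, j) \<in> S} \<le> column_lengths \<mu> i) \<and>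
     (\<forall>j. card {i. (i, j) \<in> S} \<le> column_lengths \<pi> j)"

lemma finite_rows: "finite S \<Longrightarrow> finite {j. (i, j) \<in> S}"
  using finite_vimageI[of S "Pair i"] by (simp add: vimage_def inj_on_def)

lemma finite_cols: "finite S \<Longrightarrow> finite {i. (i, j) \<in> S}"
  using finite_vimageI[of S "\<lambda>i. (i, j)"] by (simp add: vimage_def inj_on_def)

lemma bounded_subset_support:
  assumes "bounded_subset \<mu> \<pi> S" "sum_list \<mu> \<le> m" "sum_list \<pi> \<le> m"
  shows "S \<subseteq> {..<m} \<times> {..<m}"
proof (rule subsetI)
  fix e assume "e \<in> S"
  then obtain i j where e: "e = (i, j)" "(i, j) \<in> S" by (cases e) auto
  have fin: "finite S" using assms(1) by (simp add: bounded_subset_def)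
  have "0 < card {j. (i, j) \<in> S}" "0 < card {i. (i, j) \<in> S}"
    using e(2) finite_rows[OF fin, of i] finite_cols[OF fin, of j] by (auto simp: card_gt_0_iff)
  then have "column_lengths \<mu> i \<noteq> 0" "column_lengths \<pi> j \<noteq> 0"
    using assms(1) by (metis bounded_subset_def not_le)+
  then have "i < m" "j < m"
    using assms(2,3) column_lengths_eq_0[of \<mu> i] column_lengths_eq_0[of \<pi> j] by linarith+
  then show "e \<in> {..<m} \<times> {..<m}" by (simp add: e(1))
qed

text \<open>Split \<open>S\<close> at first coordinate \<open>k\<close>. The points from
  \<open>k\<close> on are bounded by the boxes of \<open>\<mu>\<close> beyond the first
  \<open>k\<close> columns. Of the others, each second coordinate \<open>j\<close> carries at most
  \<open>k\<close> and at most \<open>column_lengths \<pi> j\<close>, hence at most the boxes of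
  column \<open>j\<close> in the first \<open>k\<close> rows of \<open>\<pi>\<close>.\<close>

lemma bounded_subset_dominance:
  assumes "bounded_subset \<mu> \<pi> S" "sorted_wrt (\<ge>) \<pi>"
  shows "dominance \<mu> \<pi> (card S) k"
proof -
  define m where "m = sum_list \<mu> + sum_list \<pi>"
  have fin: "finite S" using assms(1) by (simp add: bounded_subset_def)
  have sup: "S \<subseteq> {..<m} \<times> {..<m}"
    by (rule bounded_subset_support[OF assms(1)]) (auto simp: m_def)
  let ?T = "{e \<in> S. fst e \<ge> k}" and ?H = "{e \<in> S. fst e < k}"
  have "?T = (SIGMA i:{..<m} - {..<k}. {j. (i, j) \<in> S})" using sup by auto
  then have "card ?T = (\<Sum>i\<in>{..<m} - {..<k}. card {j. (i, j) \<in> S})"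
    by (simp add: finite_rows fin)
  also have "\<dots> \<le> sum (column_lengths \<mu>) ({..<m} - {..<k})"
    using assms(1) by (intro sum_mono) (simp add: bounded_subset_def)
  also have "\<dots> = (\<Sum>a\<leftarrow>\<mu>. a - k)" by (rule sum_column_lengths_tail) (simp add: m_def)
  finally have T: "card ?T \<le> (\<Sum>a\<leftarrow>\<mu>. a - k)" .
  \<comment> \<open>Swapping the coordinates lets the points be grouped by the second one.\<close>
  have "card ?H = card (prod.swap ` ?H)" by (simp add: card_image)
  also have "prod.swap ` ?H = (SIGMA j:{..<m}. {i. (i, j) \<in> S \<and> i < k})" using sup by force
  also have "card \<dots> = (\<Sum>j<m. card {i. (i, j) \<in> S \<and> i < k})"
    by (simp add: fin finite_subset[OF _ finite_cols[OF fin]])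
  also have "\<dots> \<le> (\<Sum>j<m. card {b. b < length \<pi> \<and> b < k \<and> j < \<pi> ! b})"
  proof (rule sum_mono)
    fix j
    have "card {i. (i, j) \<in> S \<and> i < k} \<le> card {i. (i, j) \<in> S}"
      by (rule card_mono) (auto simp: finite_cols fin)
    moreover have "card {i. (i, j) \<in> S \<and> i < k} \<le> card {..<k}"
      by (rule card_mono) auto
    ultimately have "card {i. (i, j) \<in> S \<and> i < k} \<le> min (column_lengths \<pi> j) k"
      using assms(1) by (auto simp: bounded_subset_def intro: order_trans)
    then show "card {i. (i, j) \<in> S \<and> i < k} \<le> card {b. b < length \<pi> \<and> b < k \<and> j < \<pi> ! b}"
      using min_column_lengths[OF assms(2), of j k] by linarith
  qed
  also have "\<dots> = sum_list (take k \<pi>)" by (rule sum_card_first_parts) (simp add: m_def)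
  finally have H: "card ?H \<le> sum_list (take k \<pi>)" .
  have "S = ?T \<union> ?H" by auto
  then have "card S \<le> card ?T + card ?H" by (metis card_Un_le)
  with T H show ?thesis by (simp add: dominance_def)
qed

text \<open>Apply \<open>capacitated_subgraph\<close> to a full square grid and compare a cut
  \<open>(I, J)\<close> with the inequality for \<open>k = card I\<close>. Each second coordinate
  \<open>j\<close> contributes its column length if outside \<open>J\<close>, and \<open>k\<close>
  through the rectangle if inside. Both are at least the number of boxes of column \<open>j\<close>
  in the first \<open>k\<close> rows of \<open>\<pi>\<close>.\<close>

lemma dominance_bounded_subset:
  assumes "\<And>k. dominance \<mu> \<pi> N k"
  shows "\<exists>S. bounded_subset \<mu> \<pi> S \<and> card S = N"
proof -
  define m where "m = sum_list \<mu> + sum_list \<pi>"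
  let ?R = "{..<m}"
  have "\<exists>S\<subseteq>?R \<times> ?R. card S = N \<and> (\<forall>i\<in>?R. card {j. (i, j) \<in> S} \<le> column_lengths \<mu> i)
           \<and> (\<forall>j\<in>?R. card {i. (i, j) \<in> S} \<le> column_lengths \<pi> j)"
  proof (rule capacitated_subgraph)
    fix I J assume IJ: "I \<subseteq> ?R" "J \<subseteq> ?R"
    define k where "k = card I"
    have fin: "finite I" "finite J" using IJ by (meson finite_lessThan finite_subset)+
    have "(?R \<times> ?R) \<inter> I \<times> J = I \<times> J" using IJ by auto
    then have rect: "card ((?R \<times> ?R) \<inter> I \<times> J) = (\<Sum>j\<in>J. k)" by (simp add: k_def card_cartesian_product)
    have "(\<Sum>a\<leftarrow>\<mu>. a - k) \<le> sum (column_lengths \<mu>) (?R - I)"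
      unfolding k_def by (rule sum_column_lengths_Diff_ge) (auto simp: m_def fin)
    moreover have "sum_list (take k \<pi>) \<le> sum (column_lengths \<pi>) (?R - J) + (\<Sum>j\<in>J. k)"
    proof -
      let ?f = "\<lambda>j. card {b. b < length \<pi> \<and> b < k \<and> j < \<pi> ! b}"
      have "sum_list (take k \<pi>) = sum ?f ?R"
        by (rule sum_card_first_parts[symmetric]) (simp add: m_def)
      also have "\<dots> = sum ?f (?R - J) + sum ?f J" using IJ(2) by (intro sum.subset_diff) auto
      also have "\<dots> \<le> sum (column_lengths \<pi>) (?R - J) + (\<Sum>j\<in>J. k)"
      proof (intro add_mono sum_mono)
        fix j show "?f j \<le> column_lengths \<pi> j"
          unfolding column_lengths_def by (rule card_mono) auto
        have "?f j \<le> card {..<k}" by (rule card_mono) auto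
        then show "?f j \<le> k" by simp
      qed
      finally show ?thesis .
    qed
    ultimately show "N \<le> sum (column_lengths \<mu>) (?R - I) + sum (column_lengths \<pi>) (?R - J)
        + card ((?R \<times> ?R) \<inter> I \<times> J)"
      using assms[of k] rect unfolding dominance_def by linarith
  qed auto
  then obtain S where S: "S \<subseteq> ?R \<times> ?R" "card S = N"
    "\<And>i. i < m \<Longrightarrow> card {j. (i, j) \<in> S} \<le> column_lengths \<mu> i"
    "\<And>j. j < m \<Longrightarrow> card {i. (i, j) \<in> S} \<le> column_lengths \<pi> j" by auto
  have "card {j. (i, j) \<in> S} \<le> column_lengths \<mu> i" for i
  proof (cases "i < m")
    case False
    then have "{j. (i, j) \<in> S} = {}" using S(1) by auto
    then show ?thesis by simp
  qed (rule S(3))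
  moreover have "card {i. (i, j) \<in> S} \<le> column_lengths \<pi> j" for j
  proof (cases "j < m")
    case False
    then have "{i. (i, j) \<in> S} = {}" using S(1) by auto
    then show ?thesis by simp
  qed (rule S(4))
  moreover have "finite S" using S(1) by (rule finite_subset) simp
  ultimately show ?thesis using S(2) by (auto simp: bounded_subset_def)
qed

section \<open>Passing between plane sets and point sets in space\<close>

lemma ex_list_with_counts:
  fixes f :: "nat \<Rightarrow> nat"
  shows "\<exists>xs. length xs = sum f {..<m} \<and>
    (\<forall>i. card {k. k < length xs \<and> xs ! k = i} = (if i < m then f i else 0))"
proof -
  have *: "count_list (concat (map (\<lambda>i. replicate (f i) i) [0..<m])) i = (if i < m then f i else 0)" for i
  proof (induction m)
    case (Suc m)
    moreover have "count_list (replicate n x) i = (if x = i then n else 0)" for n and x :: nat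
      by (induction n) auto
    ultimately show ?case by auto
  qed simp
  have "length (concat (map (\<lambda>i. replicate (f i) i) [0..<m])) = sum f {..<m}"
    by (induction m) simp_all
  moreover have "card {k. k < length xs \<and> xs ! k = i} = count_list xs i" for xs and i :: nat
    unfolding count_list_eq_length_filter length_filter_conv_card
    by (rule arg_cong[of _ _ card]) auto
  ultimately show ?thesis using * by metis
qed

lemma marginals_alt:
  "x_marginal P i = card {e \<in> P. fst e = i}"
  "y_marginal P i = card {e \<in> P. fst (snd e) = i}"
  "z_marginal P i = card {e \<in> P. snd (snd e) = i}"
  unfolding x_marginal_def y_marginal_def z_marginal_def by (rule arg_cong[of _ _ card]; auto)+

lemma column_lengths_hook:
  assumes "p \<ge> 1"
  shows "column_lengths (p # replicate q 1) i = (if i = 0 then Suc q else if i < p then 1 else 0)"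
proof -
  have "j < Suc q \<and> i < (p # replicate q 1) ! j \<longleftrightarrow> j < Suc q \<and> (i = 0 \<or> i < p \<and> j = 0)" for j
    using assms by (cases j) auto
  then have "{j. j < Suc q \<and> i < (p # replicate q 1) ! j} =
      (if i = 0 then {..<Suc q} else if i < p then {0} else {})"
    using assms by auto
  then show ?thesis by (simp add: column_lengths_def)
qed

text \<open>Since \<open>card\<close> is 0 on infinite sets, positivity of the count expresses
  existence only for a finite family. Points occur only where all marginals are nonzero, which
  confines every \<open>P\<close> to one box.\<close>

lemma finite_point_sets:
  "finite {P. finite P \<and> x_marginal P = column_lengths lam \<and>
     y_marginal P = column_lengths \<mu> \<and> z_marginal P = column_lengths \<pi>}"
proof (rule finite_subset)
  show "finite (Pow ({..<sum_list lam} \<times> {..<sum_list \<mu>} \<times> {..<sum_list \<pi>}))" by simp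
  show "{P. finite P \<and> x_marginal P = column_lengths lam \<and>
     y_marginal P = column_lengths \<mu> \<and> z_marginal P = column_lengths \<pi>}
    \<subseteq> Pow ({..<sum_list lam} \<times> {..<sum_list \<mu>} \<times> {..<sum_list \<pi>})"
  proof (intro subsetI PowI)
    fix P e
    assume "P \<in> {P. finite P \<and> x_marginal P = column_lengths lam \<and>
     y_marginal P = column_lengths \<mu> \<and> z_marginal P = column_lengths \<pi>}" and e: "e \<in> P"
    then have P: "finite P" "x_marginal P = column_lengths lam"
      "y_marginal P = column_lengths \<mu>" "z_marginal P = column_lengths \<pi>" by auto
    obtain x y z where xyz: "e = (x, y, z)" by (cases e)
    have nz: "card {f \<in> P. Q f} \<noteq> 0" if "Q e" for Q
    proof -
      have "{f \<in> P. Q f} \<noteq> {}" using that e by blast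
      then show ?thesis using P(1) by (simp del: Collect_empty_eq)
    qed
    have "x_marginal P x \<noteq> 0" "y_marginal P y \<noteq> 0" "z_marginal P z \<noteq> 0"
      unfolding marginals_alt by (rule nz; simp add: xyz)+
    then have "x < sum_list lam" "y < sum_list \<mu>" "z < sum_list \<pi>"
      unfolding P(2-4) using column_lengths_eq_0 not_less by blast+
    then show "e \<in> {..<sum_list lam} \<times> {..<sum_list \<mu>} \<times> {..<sum_list \<pi>}"
      by (simp add: xyz)
  qed
qed

lemma point_set_count_pos_iff:
  "0 < point_set_count lam \<mu> \<pi> \<longleftrightarrow> (\<exists>P. finite P \<and> x_marginal P = column_lengths lam \<and>
     y_marginal P = column_lengths \<mu> \<and> z_marginal P = column_lengths \<pi>)"
  using finite_point_sets[of lam \<mu> \<pi>] by (auto simp: point_set_count_def card_gt_0_iff)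

text \<open>A row or column of the slice injects into the fibre of \<open>P\<close> counted by the
  corresponding marginal.\<close>

lemma bounded_subset_slice:
  assumes "finite P" "y_marginal P = column_lengths \<mu>" "z_marginal P = column_lengths \<pi>"
  shows "bounded_subset \<mu> \<pi> {(y, z). (x, y, z) \<in> P}"
proof -
  have "finite {(y, z). (x, y, z) \<in> P}"
    by (rule finite_subset[of _ "snd ` P"]) (use assms in force)+
  moreover have "card {z. (x, y, z) \<in> P} \<le> y_marginal P y" for y
    unfolding marginals_alt
    by (rule card_inj_on_le[of "\<lambda>z. (x, y, z)"]) (use assms(1) in \<open>auto simp: inj_on_def\<close>)
  moreover have "card {y. (x, y, z) \<in> P} \<le> z_marginal P z" for z
    unfolding marginals_alt
    by (rule card_inj_on_le[of "\<lambda>y. (x, y, z)"]) (use assms(1) in \<open>auto simp: inj_on_def\<close>)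
  ultimately show ?thesis using assms by (simp add: bounded_subset_def)
qed

lemma card_slice: "card {(y, z). (x, y, z) \<in> P} = x_marginal P x"
proof -
  have "{e \<in> P. fst e = x} = Pair x ` {(y, z). (x, y, z) \<in> P}" by auto
  then show ?thesis by (simp add: marginals_alt card_image inj_on_def)
qed

text \<open>Here \<open>d\<close> is the part of the column lengths already used, and
  \<open>xs\<close> lists the missing coordinates with multiplicity, in any order.\<close>

lemma ex_list_residual:
  fixes d :: "nat \<Rightarrow> nat"
  assumes "\<And>i. d i \<le> column_lengths \<alpha> i" "sum d {..<sum_list \<alpha>} = N"
  shows "\<exists>xs. length xs = sum_list \<alpha> - N \<and>
    (\<forall>i. d i + card {k. k < length xs \<and> xs ! k = i} = column_lengths \<alpha> i)"
proof -
  let ?m = "sum_list \<alpha>"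
  obtain xs where xs: "length xs = (\<Sum>i<?m. column_lengths \<alpha> i - d i)"
    "\<And>i. card {k. k < length xs \<and> xs ! k = i} = (if i < ?m then column_lengths \<alpha> i - d i else 0)"
    using ex_list_with_counts[of "\<lambda>i. column_lengths \<alpha> i - d i" ?m] by auto
  have "length xs = ?m - N"
    using xs(1) sum_subtractf_nat[of "{..<?m}" d "column_lengths \<alpha>"] assms
      sum_column_lengths[of \<alpha>] by simp
  moreover have "d i + card {k. k < length xs \<and> xs ! k = i} = column_lengths \<alpha> i" for i
    using xs(2)[of i] assms(1)[of i] column_lengths_eq_0[of \<alpha> i]
    by (cases "i < ?m") auto
  ultimately show ?thesis by blast
qed

text \<open>\<open>S\<close> becomes the slice \<open>x = 0\<close>; the residual coordinates are
  paired arbitrarily. Giving the \<open>k\<close>-th pair the first coordinate \<open>Suc k\<close>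
  keeps all points distinct.\<close>

lemma ex_point_set:
  assumes S: "bounded_subset \<mu> \<pi> S" "card S = Suc q"
    and sums: "sum_list \<mu> = p + q" "sum_list \<pi> = p + q" and "p \<ge> 1"
  shows "\<exists>P. finite P \<and> x_marginal P = column_lengths (p # replicate q 1) \<and>
     y_marginal P = column_lengths \<mu> \<and> z_marginal P = column_lengths \<pi>"
proof -
  let ?m = "p + q"
  have fin: "finite S" using S(1) by (simp add: bounded_subset_def)
  have sup: "S \<subseteq> {..<?m} \<times> {..<?m}" by (rule bounded_subset_support[OF S(1)]) (simp_all add: sums)
  have "(SIGMA i:{..<?m}. {j. (i, j) \<in> S}) = S" using sup by auto
  then have rows: "(\<Sum>i<?m. card {j. (i, j) \<in> S}) = card S"
    using card_SigmaI[of "{..<?m}" "\<lambda>i. {j. (i, j) \<in> S}"] by (simp add: finite_rows fin)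
  have "(SIGMA j:{..<?m}. {i. (i, j) \<in> S}) = prod.swap ` S" using sup by force
  moreover have "card (prod.swap ` S) = card S" by (simp add: card_image)
  ultimately have cols: "(\<Sum>j<?m. card {i. (i, j) \<in> S}) = card S"
    using card_SigmaI[of "{..<?m}" "\<lambda>j. {i. (i, j) \<in> S}"] by (simp add: finite_cols fin)
  \<comment> \<open>The residue has size \<open>(p + q) - (q + 1)\<close>, one for each slice with
    \<open>1 \<le> x < p\<close>.\<close>
  obtain ys where ys: "length ys = p - 1"
    "\<And>i. card {j. (i, j) \<in> S} + card {k. k < length ys \<and> ys ! k = i} = column_lengths \<mu> i"
    using ex_list_residual[of "\<lambda>i. card {j. (i, j) \<in> S}" \<mu> "card S"] S rows sums
    by (auto simp: bounded_subset_def)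
  obtain zs where zs: "length zs = p - 1"
    "\<And>j. card {i. (i, j) \<in> S} + card {k. k < length zs \<and> zs ! k = j} = column_lengths \<pi> j"
    using ex_list_residual[of "\<lambda>j. card {i. (i, j) \<in> S}" \<pi> "card S"] S cols sums
    by (auto simp: bounded_subset_def)
  define pt where "pt k = (Suc k, ys ! k, zs ! k)" for k
  define P where "P = (\<lambda>(y, z). (0, y, z)) ` S \<union> pt ` {..<p - 1}"
  have injpt: "inj_on pt K" for K by (auto simp: inj_on_def pt_def)
  have "x_marginal P i = column_lengths (p # replicate q 1) i" for i
  proof (cases i)
    case 0
    have "{(y, z). (0, y, z) \<in> P} = S" by (auto simp: P_def pt_def)
    then show ?thesis unfolding 0 column_lengths_hook[OF \<open>p \<ge> 1\<close>]
      using card_slice[of 0 P] S(2) by simp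
  next
    case (Suc k)
    have "{e \<in> P. fst e = i} = (if i < p then {pt k} else {})"
      by (auto simp: P_def pt_def Suc)
    then show ?thesis unfolding column_lengths_hook[OF \<open>p \<ge> 1\<close>] marginals_alt
      by (simp add: Suc)
  qed
  moreover have "y_marginal P i = column_lengths \<mu> i" for i
  proof -
    have "{e \<in> P. fst (snd e) = i} =
        (\<lambda>j. (0, i, j)) ` {j. (i, j) \<in> S} \<union> pt ` {k. k < length ys \<and> ys ! k = i}"
      by (auto simp: P_def pt_def ys(1))
    then have "y_marginal P i =
        card ((\<lambda>j. (0::nat, i, j)) ` {j. (i, j) \<in> S}) + card (pt ` {k. k < length ys \<and> ys ! k = i})"
      unfolding marginals_alt by (simp only:) (rule card_Un_disjoint, auto simp: finite_rows[OF fin] pt_def)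
    then show ?thesis using ys(2)[of i] by (simp add: card_image[OF injpt] card_image inj_on_def)
  qed
  moreover have "z_marginal P j = column_lengths \<pi> j" for j
  proof -
    have "{e \<in> P. snd (snd e) = j} =
        (\<lambda>i. (0, i, j)) ` {i. (i, j) \<in> S} \<union> pt ` {k. k < length zs \<and> zs ! k = j}"
      by (auto simp: P_def pt_def zs(1))
    then have "z_marginal P j =
        card ((\<lambda>i. (0::nat, i, j)) ` {i. (i, j) \<in> S}) + card (pt ` {k. k < length zs \<and> zs ! k = j})"
      unfolding marginals_alt by (simp only:) (rule card_Un_disjoint, auto simp: finite_cols[OF fin] pt_def)
    then show ?thesis using zs(2)[of j] by (simp add: card_image[OF injpt] card_image inj_on_def)
  qed
  moreover have "finite P" by (simp add: P_def fin)
  ultimately show ?thesis by blast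
qed

text \<open>Finitely many \<open>k\<close> suffice: beyond \<open>length \<pi>\<close> the whole of
  \<open>\<pi>\<close> is taken, and its size \<open>p + q\<close> is at least
  \<open>q + 1 = length lam\<close>.\<close>

lemma point_set_count_hook:
  assumes "is_hook lam" "is_partition \<pi>" "sum_list lam = sum_list \<mu>" "sum_list \<mu> = sum_list \<pi>"
  shows "0 < point_set_count lam \<mu> \<pi> \<longleftrightarrow> (\<forall>k\<le>length \<pi>. dominance \<mu> \<pi> (length lam) k)"
proof -
  obtain p q where pq: "p \<ge> 1" "lam = p # replicate q 1" using assms(1) by (auto simp: is_hook_def)
  have sums: "sum_list \<mu> = p + q" "sum_list \<pi> = p + q" using assms pq by (auto simp: sum_list_replicate)
  show ?thesis
  proof
    assume "0 < point_set_count lam \<mu> \<pi>"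
    then obtain P where P: "finite P" "x_marginal P = column_lengths lam"
      "y_marginal P = column_lengths \<mu>" "z_marginal P = column_lengths \<pi>"
      by (auto simp: point_set_count_pos_iff)
    have "card {(y, z). (0, y, z) \<in> P} = length lam"
      unfolding card_slice P(2) pq(2) column_lengths_hook[OF pq(1)] by simp
    then show "\<forall>k\<le>length \<pi>. dominance \<mu> \<pi> (length lam) k"
      using bounded_subset_dominance[OF bounded_subset_slice[OF P(1,3,4), of 0]] assms(2)
      by (simp add: is_partition_def)
  next
    assume d: "\<forall>k\<le>length \<pi>. dominance \<mu> \<pi> (length lam) k"
    have "dominance \<mu> \<pi> (length lam) k" for k
    proof (cases "k \<le> length \<pi>")
      case False
      then show ?thesis using sums pq by (simp add: dominance_def)
    qed (use d in simp)
    from dominance_bounded_subset[OF this] obtain S where "bounded_subset \<mu> \<pi> S" "card S = Suc q"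
      using pq by auto
    from ex_point_set[OF this sums pq(1)] show "0 < point_set_count lam \<mu> \<pi>"
      by (simp add: point_set_count_pos_iff pq(2))
  qed
qed

section \<open>The machine\<close>

text \<open>The scanning states: 1 reads \<open>lam\<close>; 2 and 3 read a part of \<open>\<mu>\<close> in which no stroke, respectively
  one stroke, has been marked during the current pass; 4, 5 and 6 read \<open>\<pi>\<close> before, inside and after
  the part that is marked during the current pass. Symbol 4 is a marked stroke.\<close>

definition scan_state :: "nat \<Rightarrow> nat \<Rightarrow> nat" where
  "scan_state s a =
     (if s = 1 \<and> a = 3 then 2
      else if s = 2 \<and> a = 1 then 3
      else if s = 2 \<and> a = 3 then 4
      else if s = 3 \<and> a = 2 then 2
      else if s = 4 \<and> a = 1 then 5
      else if s = 5 \<and> a = 2 then 6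
      else s)"

definition scan_write :: "nat \<Rightarrow> nat \<Rightarrow> nat" where
  "scan_write s a = (if s \<in> {2, 4, 5} \<and> a = 1 then 4 else a)"

definition counter_up :: "nat \<Rightarrow> nat \<Rightarrow> bool" where
  "counter_up s a \<longleftrightarrow> s = 1 \<and> a = 2"

definition counter_down :: "nat \<Rightarrow> nat \<Rightarrow> bool" where
  "counter_down s a \<longleftrightarrow> s \<in> {2, 3} \<and> a = 1 \<or> s \<in> {4, 5, 6} \<and> a = 4"

text \<open>The truncated subtraction mirrors the machine, whose counter head does not move left
  from the marked cell 0.\<close>

definition scan_count :: "nat \<Rightarrow> nat \<Rightarrow> nat \<Rightarrow> nat" where
  "scan_count s a c = (if counter_up s a then c + 1 else if counter_down s a then c - 1 else c)"

text \<open>A model of one sweep on words alone, without tapes and head positions; it returns the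
  final state, the counter and the rewritten word.\<close>

fun scan :: "nat \<Rightarrow> nat \<Rightarrow> nat list \<Rightarrow> nat \<times> nat \<times> nat list" where
  "scan s c [] = (s, c, [])"
| "scan s c (a # w) =
     (case scan (scan_state s a) (scan_count s a c) w of (s', c', w') \<Rightarrow> (s', c', scan_write s a # w'))"

lemmas scan_defs = scan_state_def scan_write_def scan_count_def counter_up_def counter_down_def

lemma scan_append:
  "scan s c (u @ v) = (case scan s c u of (s', c', u') \<Rightarrow>
     (case scan s' c' v of (s'', c'', v') \<Rightarrow> (s'', c'', u' @ v')))"
  by (induction u arbitrary: s c) (auto split: prod.splits)

text \<open>State 0, in which the machine starts, rewinds the input tape. The second tape is a counter: its
  value is the position of the head, and cell 0 carries the symbol 1.\<close>

definition hook_delta :: "nat \<Rightarrow> nat list \<Rightarrow> nat \<times> (nat \<times> direction) list" where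
  "hook_delta s syms = (let a = syms ! 0; b = syms ! 1 in
     if s = 0 then
       if a = 0 then (1, [(0, Move_Right), (1, Stay)]) else (0, [(a, Move_Left), (b, Stay)])
     else if a = 0 then
       if b = 0 then (8, [(a, Stay), (b, Stay)])
       else if s = 4 then (7, [(a, Stay), (b, Stay)])
       else (0, [(a, Move_Left), (b, Stay)])
     else (scan_state s a, [(scan_write s a, Move_Right),
       (b, if counter_up s a then Move_Right else if counter_down s a \<and> b = 0 then Move_Left else Stay)]))"

definition hook_tm :: tm where
  "hook_tm = \<lparr>tm_tapes = 2, tm_symbols = 5, tm_states = 9, tm_start = 0, tm_accept = 7,
     tm_reject = 8, tm_delta = hook_delta\<rparr>"

lemma wf_hook_tm: "wf_tm hook_tm"
proof -
  have "case hook_delta s syms of (s', acts) \<Rightarrow>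
          s' < 9 \<and> length acts = 2 \<and> fst ` set acts \<subseteq> {..<5}"
    if "s < 9" "length syms = 2" "set syms \<subseteq> {..<5}" for s syms
  proof -
    have "syms ! 0 < 5" "syms ! 1 < 5" using that(2,3) by (auto simp: subset_iff)
    with that(1) show ?thesis
      by (simp add: hook_delta_def Let_def scan_state_def scan_write_def)
  qed
  then show ?thesis by (simp add: wf_tm_def hook_tm_def)
qed

section \<open>Tape contents and runs of the machine\<close>

definition word_tape :: "nat list \<Rightarrow> int \<Rightarrow> nat" where
  "word_tape w i = (if 0 \<le> i \<and> i < int (length w) then w ! nat i else 0)"

definition counter_tape :: "int \<Rightarrow> nat" where
  "counter_tape = (\<lambda>_. 0)(0 := 1)"

lemma word_tape_append: "word_tape (u @ a # v) (int (length u)) = a"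
  by (simp add: word_tape_def)

lemma word_tape_update:
  "(word_tape (u @ a # v))(int (length u) := b) = word_tape (u @ b # v)"
proof
  fix i
  show "((word_tape (u @ a # v))(int (length u) := b)) i = word_tape (u @ b # v) i"
  proof (cases "i = int (length u)")
    case False
    then have "(u @ a # v) ! nat i = (u @ b # v) ! nat i" if "0 \<le> i"
      using that by (auto simp: nth_append nth_Cons' nat_less_iff)
    with False show ?thesis by (auto simp: word_tape_def)
  qed (simp add: word_tape_append)
qed

lemma word_tape_eq_0: "i < 0 \<or> i \<ge> int (length w) \<Longrightarrow> word_tape w i = 0"
  by (auto simp: word_tape_def)

lemma word_tape_neq_0: "0 \<notin> set w \<Longrightarrow> 0 \<le> i \<Longrightarrow> i < int (length w) \<Longrightarrow> word_tape w i \<noteq> 0"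
  using nth_mem[of "nat i" w] by (metis nat_less_iff word_tape_def)

lemma hook_step:
  assumes "s \<noteq> 7" "s \<noteq> 8"
  shows "tm_step hook_tm (s, [(f, i), (g, j)]) =
    (case hook_delta s [f i, g j] of (s', acts) \<Rightarrow> (s', map2 tape_act acts [(f, i), (g, j)]))"
  using assms by (simp add: hook_tm_def tape_read_def)

lemma hook_step_scan:
  assumes "s \<in> {1..6}" "a \<noteq> 0"
  shows "tm_step hook_tm (s, [(word_tape (u @ a # v), int (length u)), (counter_tape, int c)]) =
    (scan_state s a, [(word_tape ((u @ [scan_write s a]) @ v), int (length (u @ [scan_write s a]))),
       (counter_tape, int (scan_count s a c))])"
proof -
  \<comment> \<open>The symbol under the counter head is nonblank exactly at value 0, so the machine
    can detect zero.\<close>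
  have "counter_tape (int c) = (if c = 0 then 1 else 0)" by (simp add: counter_tape_def)
  moreover have "c > 0 \<Longrightarrow> int c - 1 = int (c - 1)" by simp
  ultimately show ?thesis using assms
    by (subst hook_step)
      (auto simp: hook_delta_def word_tape_append word_tape_update scan_count_def counter_up_def
         counter_down_def)
qed

lemma scan_state_range: "s \<in> {1..6} \<Longrightarrow> scan_state s a \<in> {1..6}"
  by (auto simp: scan_state_def)

text \<open>The already rewritten prefix \<open>u\<close> is arbitrary, so that the induction can
  follow the head to the right.\<close>

lemma hook_run_scan:
  assumes "s \<in> {1..6}" "0 \<notin> set v" "scan s c v = (s', c', v')"
  shows "(tm_step hook_tm ^^ length v) (s, [(word_tape (u @ v), int (length u)), (counter_tape, int c)]) =
    (s', [(word_tape (u @ v'), int (length (u @ v))), (counter_tape, int c')])"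
  using assms
proof (induction v arbitrary: s c u v')
  case Nil
  then show ?case by simp
next
  case (Cons a v)
  obtain w where w: "scan (scan_state s a) (scan_count s a c) v = (s', c', w)"
    and v': "v' = scan_write s a # w"
    using Cons.prems(3) by (auto split: prod.splits)
  have "(tm_step hook_tm ^^ length v) (scan_state s a,
      [(word_tape ((u @ [scan_write s a]) @ v), int (length (u @ [scan_write s a]))),
       (counter_tape, int (scan_count s a c))]) =
    (s', [(word_tape ((u @ [scan_write s a]) @ w), int (length ((u @ [scan_write s a]) @ v))),
      (counter_tape, int c')])"
    using Cons.prems by (intro Cons.IH scan_state_range w) auto
  then show ?case using Cons.prems(1,2)
    by (simp add: funpow_Suc_right hook_step_scan v' del: funpow.simps tm_step.simps)
qed

text \<open>\<open>n\<close> steps cross the letters to the left and one more turns around on the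
  blank cell -1. The condition on \<open>g\<close> covers both the blank second tape at the start
  and the marked one of later passes.\<close>

lemma hook_run_rewind:
  assumes "0 \<notin> set w" "n \<le> length w" "g(0 := 1) = counter_tape"
  shows "(tm_step hook_tm ^^ Suc n) (0, [(word_tape w, int n - 1), (g, 0)]) =
    (1, [(word_tape w, 0), (counter_tape, 0)])"
  using assms(2)
proof (induction n)
  case 0
  have "(word_tape w)(- 1 := 0) = word_tape w" by (auto simp: word_tape_def)
  then show ?case using assms(3)
    by (simp add: hook_step hook_delta_def word_tape_eq_0 del: tm_step.simps)
next
  case (Suc n)
  have "word_tape w (int n) \<noteq> 0" using Suc.prems assms(1) by (intro word_tape_neq_0) auto
  then have "tm_step hook_tm (0, [(word_tape w, int (Suc n) - 1), (g, 0)]) =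
      (0, [(word_tape w, int n - 1), (g, 0)])"
    by (simp add: hook_step hook_delta_def del: tm_step.simps)
  with Suc show ?case
    by (subst funpow_Suc_right) (simp del: tm_step.simps funpow.simps)
qed

text \<open>A positive counter means a violated inequality. State 4 at zero means that no part of
  \<open>\<pi>\<close> was left to mark, so the last pass is over; any other state starts the next
  rewind.\<close>

lemma hook_step_end:
  assumes "s \<in> {1..6}" "i = int (length w)"
  shows "tm_step hook_tm (s, [(word_tape w, i), (counter_tape, int c)]) =
    (if c \<noteq> 0 then (8, [(word_tape w, i), (counter_tape, int c)])
     else if s = 4 then (7, [(word_tape w, i), (counter_tape, int c)])
     else (0, [(word_tape w, i - 1), (counter_tape, 0)]))"
proof -
  have "(word_tape w)(int (length w) := 0) = word_tape w" by (auto simp: word_tape_def)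
  then show ?thesis using assms
    by (subst hook_step) (auto simp: hook_delta_def word_tape_eq_0 counter_tape_def)
qed

section \<open>The word after \<open>k\<close> passes and the effect of one more sweep\<close>

definition marked_mu :: "nat \<Rightarrow> nat list \<Rightarrow> nat list" where
  "marked_mu k \<mu> = concat (map (\<lambda>a. replicate (min a k) 4 @ replicate (a - k) 1 @ [2]) \<mu>) @ [3]"

definition marked_pi :: "nat \<Rightarrow> nat list \<Rightarrow> nat list" where
  "marked_pi k \<pi> = concat (map (\<lambda>a. replicate a 4 @ [2]) (take k \<pi>)) @ unary_partition (drop k \<pi>)"

lemma scan_lam_stroke: "scan 1 c (replicate a 1) = (1, c, replicate a 1)"
  by (induction a arbitrary: c) (auto simp: scan_defs)

text \<open>The counter rises at the symbol closing a part and not at strokes, hence by the number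
  of parts.\<close>

lemma scan_lam: "scan 1 c (unary_partition \<alpha>) = (2, c + length \<alpha>, unary_partition \<alpha>)"
  by (induction \<alpha> arbitrary: c)
    (auto simp: unary_partition_def scan_append scan_lam_stroke[simplified] scan_defs)

lemma scan_mu_marked: "scan 2 c (replicate a 4) = (2, c, replicate a 4)"
  by (induction a arbitrary: c) (auto simp: scan_defs)

lemma scan_mu_rest: "scan 3 c (replicate a 1) = (3, c - a, replicate a 1)"
  by (induction a arbitrary: c) (auto simp: scan_defs)

text \<open>If \<open>a \<le> k\<close>, all strokes are marked and state 2 persists. Otherwise the
  first unmarked stroke is counted and marked, state 3 only counts the other
  \<open>a - k - 1\<close>, and the closing symbol restores state 2.\<close>

lemma scan_mu_part:
  "scan 2 c (replicate (min a k) 4 @ replicate (a - k) 1 @ [2]) =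
    (2, c - (a - k), replicate (min a (Suc k)) 4 @ replicate (a - Suc k) 1 @ [2])"
proof (cases "a - k")
  case 0
  then show ?thesis by (simp add: scan_append scan_mu_marked scan_defs min_def)
next
  case (Suc d)
  then have "min a k = k" "min a (Suc k) = Suc k" "a - Suc k = d" by auto
  then show ?thesis using Suc
    by (simp add: scan_append scan_mu_marked scan_mu_rest[simplified] scan_defs replicate_app_Cons_same)
qed

lemma scan_mu: "scan 2 c (marked_mu k \<mu>) = (4, c - (\<Sum>a\<leftarrow>\<mu>. a - k), marked_mu (Suc k) \<mu>)"
proof (induction \<mu> arbitrary: c)
  case Nil
  then show ?case by (simp add: marked_mu_def scan_defs)
next
  case (Cons a \<mu>)
  have *: "marked_mu k (a # \<mu>) = (replicate (min a k) 4 @ replicate (a - k) 1 @ [2]) @ marked_mu k \<mu>" for k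
    by (simp add: marked_mu_def)
  show ?case unfolding * scan_append[of 2 c "_ @ _"] scan_mu_part by (simp add: Cons.IH)
qed

lemma scan_pi_marked: "scan 4 c (replicate a 4) = (4, c - a, replicate a 4)"
  by (induction a arbitrary: c) (auto simp: scan_defs)

lemma scan_pi_marking: "scan 5 c (replicate a 1) = (5, c, replicate a 4)"
  by (induction a arbitrary: c) (auto simp: scan_defs)

lemma scan_pi_stroke: "scan 6 c (replicate a 1) = (6, c, replicate a 1)"
  by (induction a arbitrary: c) (auto simp: scan_defs)

lemma scan_pi_rest: "scan 6 c (unary_partition \<pi>) = (6, c, unary_partition \<pi>)"
  by (induction \<pi> arbitrary: c)
    (auto simp: unary_partition_def scan_append scan_pi_stroke[simplified] scan_defs)

text \<open>Strokes marked in earlier passes are counted, those being marked now are not; hence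
  \<open>take k\<close> beside \<open>marked_pi (Suc k)\<close>. Positivity matters because state 4
  finds the next part by its first stroke and would pass over an empty one.\<close>

lemma scan_pi:
  assumes "\<forall>a \<in> set \<pi>. a > 0"
  shows "scan 4 c (marked_pi k \<pi>) =
    (if k < length \<pi> then 6 else 4, c - sum_list (take k \<pi>), marked_pi (Suc k) \<pi>)"
  using assms
proof (induction \<pi> arbitrary: c k)
  case Nil
  then show ?case by (simp add: marked_pi_def unary_partition_def scan_defs)
next
  case (Cons a \<pi>)
  show ?case
  proof (cases k)
    case 0
    obtain d where d: "a = Suc d" using Cons.prems by (cases a) auto
    have "marked_pi k (a # \<pi>) = 1 # replicate d 1 @ 2 # unary_partition \<pi>"
      by (simp add: marked_pi_def 0 unary_partition_def d)
    then show ?thesis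
      by (simp add: 0 scan_append scan_pi_marking[simplified] scan_pi_rest scan_defs marked_pi_def d)
  next
    case (Suc k')
    have *: "marked_pi (Suc k) (a # \<pi>) = replicate a 4 @ 2 # marked_pi k \<pi>" for k
      by (simp add: marked_pi_def)
    show ?thesis unfolding Suc *
      using Cons by (simp add: scan_append scan_pi_marked scan_defs)
  qed
qed

definition marked_word :: "nat list \<Rightarrow> nat list \<Rightarrow> nat list \<Rightarrow> nat \<Rightarrow> nat list" where
  "marked_word lam \<mu> \<pi> k = unary_partition lam @ marked_mu k \<mu> @ marked_pi k \<pi>"

lemma marked_word_0: "marked_word lam \<mu> \<pi> 0 = unary_triple (lam, \<mu>, \<pi>)"
  by (simp add: marked_word_def marked_mu_def marked_pi_def unary_partition_def)

lemma scan_marked_word: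
  assumes "\<forall>a \<in> set \<pi>. a > 0"
  shows "scan 1 0 (marked_word lam \<mu> \<pi> k) = (if k < length \<pi> then 6 else 4,
    length lam - (\<Sum>a\<leftarrow>\<mu>. a - k) - sum_list (take k \<pi>), marked_word lam \<mu> \<pi> (Suc k))"
  by (simp add: marked_word_def scan_append scan_lam[simplified] scan_mu scan_pi[OF assms])

lemma scan_length: "scan s c w = (s', c', w') \<Longrightarrow> length w' = length w"
  by (induction w arbitrary: s c w') (auto split: prod.splits)

text \<open>Sweeps rewrite symbols in place, so one length bounds the time of every pass.\<close>

lemma length_marked_word:
  assumes "\<forall>a \<in> set \<pi>. a > 0"
  shows "length (marked_word lam \<mu> \<pi> k) = length (unary_triple (lam, \<mu>, \<pi>))"
  by (induction k) (simp_all add: marked_word_0 scan_length[OF scan_marked_word[OF assms]]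
      del: unary_triple.simps)

lemma zero_notin_marked_word: "0 \<notin> set (marked_word lam \<mu> \<pi> k)"
  by (auto simp: marked_word_def marked_mu_def marked_pi_def unary_partition_def)

section \<open>Passes, verdict and running time\<close>

lemma hook_run_pass:
  assumes "\<forall>a \<in> set \<pi>. a > 0" "n \<le> length (marked_word lam \<mu> \<pi> k)" "g(0 := 1) = counter_tape"
  defines "w \<equiv> marked_word lam \<mu> \<pi>"
  defines "conf \<equiv> (tm_step hook_tm ^^ (n + length (w k) + 2)) (0, [(word_tape (w k), int n - 1), (g, 0)])"
  shows "\<not> dominance \<mu> \<pi> (length lam) k \<Longrightarrow> fst conf = 8"
    and "dominance \<mu> \<pi> (length lam) k \<Longrightarrow> length \<pi> \<le> k \<Longrightarrow> fst conf = 7"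
    and "dominance \<mu> \<pi> (length lam) k \<Longrightarrow> k < length \<pi> \<Longrightarrow>
      conf = (0, [(word_tape (w (Suc k)), int (length (w k)) - 1), (counter_tape, 0)])"
proof -
  obtain s c :: nat where sc: "s = (if k < length \<pi> then 6 else 4)"
    "c = length lam - (\<Sum>a\<leftarrow>\<mu>. a - k) - sum_list (take k \<pi>)" by blast
  have scan: "scan 1 0 (w k) = (s, c, w (Suc k))"
    unfolding w_def sc by (rule scan_marked_word[OF assms(1)])
  \<comment> \<open>A pass consists of \<open>Suc n\<close> rewinding steps, \<open>m\<close>
    scanning steps and one step on the final blank.\<close>
  have split: "(f ^^ (n + m + 2)) x = f ((f ^^ m) ((f ^^ Suc n) x))" for f :: "config \<Rightarrow> config" and m x
  proof -
    have "n + m + 2 = Suc (m + Suc n)" by simp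
    then show ?thesis by (simp only: funpow_add comp_apply funpow.simps)
  qed
  have "conf = tm_step hook_tm ((tm_step hook_tm ^^ length (w k)) ((tm_step hook_tm ^^ Suc n)
      (0, [(word_tape (w k), int n - 1), (g, 0)])))"
    unfolding conf_def by (rule split)
  also have "(tm_step hook_tm ^^ Suc n) (0, [(word_tape (w k), int n - 1), (g, 0)]) =
      (1, [(word_tape (w k), 0), (counter_tape, 0)])"
    using assms zero_notin_marked_word by (intro hook_run_rewind) (auto simp: w_def)
  also have "(tm_step hook_tm ^^ length (w k)) \<dots> =
      (s, [(word_tape (w (Suc k)), int (length (w k))), (counter_tape, int c)])"
    using hook_run_scan[of 1 "w k" 0 s c "w (Suc k)" "[]"] scan zero_notin_marked_word
    by (simp add: w_def)
  also have "tm_step hook_tm \<dots> =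
    (if c \<noteq> 0 then (8, [(word_tape (w (Suc k)), int (length (w k))), (counter_tape, int c)])
     else if s = 4 then (7, [(word_tape (w (Suc k)), int (length (w k))), (counter_tape, int c)])
     else (0, [(word_tape (w (Suc k)), int (length (w k)) - 1), (counter_tape, 0)]))"
    by (rule hook_step_end) (auto simp: sc scan_length[OF scan])
  finally have conf: "conf = \<dots>" .
  \<comment> \<open>With truncated subtraction, a zero counter says exactly that the subtracted
    amounts reach \<open>length lam\<close>.\<close>
  have c: "c = 0 \<longleftrightarrow> dominance \<mu> \<pi> (length lam) k" by (auto simp: sc dominance_def)
  show "\<not> dominance \<mu> \<pi> (length lam) k \<Longrightarrow> fst conf = 8"
    and "dominance \<mu> \<pi> (length lam) k \<Longrightarrow> length \<pi> \<le> k \<Longrightarrow> fst conf = 7"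
    and "dominance \<mu> \<pi> (length lam) k \<Longrightarrow> k < length \<pi> \<Longrightarrow>
      conf = (0, [(word_tape (w (Suc k)), int (length (w k)) - 1), (counter_tape, 0)])"
    unfolding conf using c by (auto simp: sc(1))
qed

text \<open>Induction on the remaining passes; as \<open>n \<le> L\<close>, each takes at most
  \<open>2 * L + 2\<close> steps. \<open>n\<close> and \<open>g\<close> vary because the first pass
  starts on cell 0 with a blank counter tape, later ones on the last letter with cell 0
  marked.\<close>

lemma hook_run_verdict:
  assumes "\<forall>a \<in> set \<pi>. a > 0" "L = length (unary_triple (lam, \<mu>, \<pi>))"
    and "k \<le> length \<pi>" "n \<le> L" "g(0 := 1) = counter_tape"
  shows "\<exists>t \<le> (length \<pi> - k + 1) * (2 * L + 2).
    fst ((tm_step hook_tm ^^ t) (0, [(word_tape (marked_word lam \<mu> \<pi> k), int n - 1), (g, 0)])) =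
      (if \<forall>j. k \<le> j \<and> j \<le> length \<pi> \<longrightarrow> dominance \<mu> \<pi> (length lam) j then 7 else 8)"
  using assms(3-5)
proof (induction "length \<pi> - k" arbitrary: k n g)
  case 0
  let ?c = "(0, [(word_tape (marked_word lam \<mu> \<pi> k), int n - 1), (g, 0)])"
  have k: "k = length \<pi>" using 0 by simp
  have len: "length (marked_word lam \<mu> \<pi> k) = L" by (simp only: length_marked_word[OF assms(1)] assms(2))
  have "fst ((tm_step hook_tm ^^ (n + L + 2)) ?c) = (if dominance \<mu> \<pi> (length lam) k then 7 else 8)"
    using hook_run_pass(1,2)[OF assms(1) _ "0.prems"(3), of n lam \<mu> k] 0(3) k unfolding len by auto
  moreover have "n + L + 2 \<le> (length \<pi> - k + 1) * (2 * L + 2)" using 0(3) by simp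
  moreover have "(\<forall>j. k \<le> j \<and> j \<le> length \<pi> \<longrightarrow> dominance \<mu> \<pi> (length lam) j) \<longleftrightarrow>
      dominance \<mu> \<pi> (length lam) k"
    using k by (metis le_antisym order_refl)
  ultimately show ?case by (intro exI[of _ "n + L + 2"]) (simp only:)
next
  case (Suc d)
  let ?c = "(0, [(word_tape (marked_word lam \<mu> \<pi> k), int n - 1), (g, 0)])"
  let ?D = "dominance \<mu> \<pi> (length lam)"
  have len: "length (marked_word lam \<mu> \<pi> k) = L" by (simp only: length_marked_word[OF assms(1)] assms(2))
  have k: "k < length \<pi>" using Suc by simp
  have d: "length \<pi> - Suc k = d" "length \<pi> - k = Suc d" using Suc by auto
  show ?case
  proof (cases "?D k")
    case False
    then have "fst ((tm_step hook_tm ^^ (n + L + 2)) ?c) = 8"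
      using hook_run_pass(1)[OF assms(1) _ Suc.prems(3), of n lam \<mu> k] Suc.prems(2) unfolding len by simp
    moreover have "n + L + 2 \<le> (length \<pi> - k + 1) * (2 * L + 2)" using Suc by (simp add: d)
    moreover have "\<not> (\<forall>j. k \<le> j \<and> j \<le> length \<pi> \<longrightarrow> ?D j)" using False k by auto
    ultimately show ?thesis by (intro exI[of _ "n + L + 2"]) (simp only: if_False)
  next
    case True
    have pass: "(tm_step hook_tm ^^ (n + L + 2)) ?c =
        (0, [(word_tape (marked_word lam \<mu> \<pi> (Suc k)), int L - 1), (counter_tape, 0)])"
      using hook_run_pass(3)[OF assms(1) _ Suc.prems(3), of n lam \<mu> k] Suc.prems(2) True k
      unfolding len by simp
    have "\<exists>t \<le> (length \<pi> - Suc k + 1) * (2 * L + 2).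
      fst ((tm_step hook_tm ^^ t)
        (0, [(word_tape (marked_word lam \<mu> \<pi> (Suc k)), int L - 1), (counter_tape, 0)])) =
      (if \<forall>j. Suc k \<le> j \<and> j \<le> length \<pi> \<longrightarrow> ?D j then 7 else 8)"
      by (rule Suc.hyps(1)) (use d k in \<open>auto simp: counter_tape_def\<close>)
    then obtain t where t: "t \<le> (d + 1) * (2 * L + 2)"
      "fst ((tm_step hook_tm ^^ t)
        (0, [(word_tape (marked_word lam \<mu> \<pi> (Suc k)), int L - 1), (counter_tape, 0)])) =
        (if \<forall>j. Suc k \<le> j \<and> j \<le> length \<pi> \<longrightarrow> ?D j then 7 else 8)"
      unfolding d by (elim exE conjE)
    have "(tm_step hook_tm ^^ (t + (n + L + 2))) ?c = (tm_step hook_tm ^^ t)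
        (0, [(word_tape (marked_word lam \<mu> \<pi> (Suc k)), int L - 1), (counter_tape, 0)])"
      unfolding funpow_add[of t] comp_apply pass ..
    moreover have "(\<forall>j. Suc k \<le> j \<and> j \<le> length \<pi> \<longrightarrow> ?D j) \<longleftrightarrow> (\<forall>j. k \<le> j \<and> j \<le> length \<pi> \<longrightarrow> ?D j)"
      using True by (metis Suc_leD le_antisym not_less_eq_eq)
    moreover have "t + (n + L + 2) \<le> (length \<pi> - k + 1) * (2 * L + 2)"
      using t(1) Suc.prems by (simp add: d algebra_simps)
    ultimately show ?thesis using t(2) by (intro exI[of _ "t + (n + L + 2)"]) (simp only:)
  qed
qed

lemma length_unary_partition_ge: "length \<alpha> + 1 \<le> length (unary_partition \<alpha>)"
  by (induction \<alpha>) (auto simp: unary_partition_def)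

lemma set_unary_triple: "set (unary_triple x) \<subseteq> {1..<5}"
  by (cases x) (auto simp: unary_partition_def)

text \<open>Position 0 is written \<open>int 1 - 1\<close> to fit the form \<open>int n - 1\<close>
  of the run lemmas with \<open>n = 1\<close>.\<close>

lemma hook_tm_init: "tm_init hook_tm w = (0, [(word_tape w, int 1 - 1), (\<lambda>_. 0, 0)])"
  by (auto simp: tm_init_def hook_tm_def input_tape_def word_tape_def fun_eq_iff)

theorem theorem6p6:
  "poly_time_decidable unary_triple
     {(lam, \<mu>, \<pi>). is_partition lam \<and> is_partition \<mu> \<and> is_partition \<pi> \<and>
        sum_list lam = sum_list \<mu> \<and> sum_list \<mu> = sum_list \<pi> \<and> is_hook lam}
     (\<lambda>(lam, \<mu>, \<pi>). point_set_count lam \<mu> \<pi> > 0)"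
proof -
  have "tm_verdict_within hook_tm (unary_triple (lam, \<mu>, \<pi>))
      (poly [:0, 2, 2:] (length (unary_triple (lam, \<mu>, \<pi>)))) (point_set_count lam \<mu> \<pi> > 0)"
    if inst: "is_partition \<pi>" "sum_list lam = sum_list \<mu>" "sum_list \<mu> = sum_list \<pi>" "is_hook lam"
    for lam \<mu> \<pi>
  proof -
    define L where "L = length (unary_triple (lam, \<mu>, \<pi>))"
    have L: "length \<pi> + 1 \<le> L"
      using length_unary_partition_ge[of \<pi>] by (simp add: L_def)
    have "\<exists>t \<le> (length \<pi> - 0 + 1) * (2 * L + 2).
      fst ((tm_step hook_tm ^^ t) (0, [(word_tape (marked_word lam \<mu> \<pi> 0), int 1 - 1), (\<lambda>_. 0, 0)])) =
      (if \<forall>j. 0 \<le> j \<and> j \<le> length \<pi> \<longrightarrow> dominance \<mu> \<pi> (length lam) j then 7 else 8)"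
      by (rule hook_run_verdict)
        (use L inst(1) in \<open>auto simp: counter_tape_def is_partition_def L_def simp del: unary_triple.simps\<close>)
    then obtain t where t: "t \<le> (length \<pi> + 1) * (2 * L + 2)"
      "fst ((tm_step hook_tm ^^ t) (tm_init hook_tm (unary_triple (lam, \<mu>, \<pi>)))) =
        (if point_set_count lam \<mu> \<pi> > 0 then 7 else 8)"
      unfolding marked_word_0 hook_tm_init point_set_count_hook[OF inst(4,1-3)] by auto
    \<comment> \<open>At most \<open>length \<pi> + 1 \<le> L\<close> passes of at most
      \<open>2 * L + 2\<close> steps yield the coefficients 0, 2, 2.\<close>
    have "t \<le> L * (2 * L + 2)" using t(1) L by (meson le_trans mult_le_mono1)
    then have "t \<le> poly [:0, 2, 2:] L" by (simp add: algebra_simps)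
    with t(2) show ?thesis
      unfolding tm_verdict_within_def L_def by (intro exI[of _ t]) (simp add: hook_tm_def)
  qed
  moreover have "set (unary_triple x) \<subseteq> {1..<tm_symbols hook_tm}" for x
    using set_unary_triple by (simp add: hook_tm_def)
  ultimately show ?thesis
    unfolding poly_time_decidable_def
    by (intro exI[of _ hook_tm] exI[of _ "[:0, 2, 2:]"] conjI wf_hook_tm)
      (auto simp del: unary_triple.simps poly_pCons)
qed

end
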